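(* Let $F$ be a formula containing exactly $n$ occurrences of quantifiers ($\exists$ or $\forall$). Then every derivation by the innermost rewrite relation $\to_{\mathcal I}$ starting from $F$ and ending in a formula to which $\to$ is not applicable reaches the (unique) $\to$-normal form $F'$ of $F$ in exactly $n$ steps. Moreover, $n$ is the minimal number of $\to$-steps needed to reach $F'$ from $F$.
   Context: Terms and formulas are those of first-order logic extended by Hilbert's $\varepsilon$-binder. The syntax has: - individual variables; - formula variables; - function and predicate symbols; - the connectives; - for an individual variable $x$ and a formula $F$: the term $\varepsilon x.\,F$ and the formulas $\exists x.\,F$ and $\forall x.\,F$, each binding $x$. Formulas are identified modulo renaming of bound variables. Substitution $F\{x\mapsto t\}$ is capture-avoiding. For $Q\in\{\exists,\forall\}$, write $\neg^{\forall}$ for $\neg$ and $\neg^{\exists}$ for the empty string. The relation $F_1\to F_2$ holds iff $F_2$ is obtained from $F_1$ by replacing one occurrence of a subformula $Q x.\,A$ by $A\{x\mapsto \varepsilon x.\,\neg^{Q}A\}$. The occurrence may lie anywhere in $F_1$, including inside $\varepsilon$-terms and under binders. The innermost rewrite relation $\to_{\mathcal I}$ is the restriction of $\to$ to steps in which the rewritten subformula $Qx.\,A$ is such that $A$ contains no occurrence of a quantifier. A $\to$-normal form of $F$ is a formula $F'$ with $F\to^*F'$ such that no $\to$-step applies to $F'$. *)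

theory Defs
  imports Main
begin

text \<open>
  Terms and formulas of first-order logic with Hilbert's epsilon-binder, identified modulo renaming
  of bound variables, are represented by de Bruijn indices: each of the binders \<open>Epsilon\<close>
  and \<open>Quant Q\<close> binds index 0 in its body. Under \<open>k\<close> binders, the index
  \<open>k + i\<close> denotes the \<open>i\<close>-th free individual variable.

  A function or predicate symbol may be applied to argument lists of any length; a symbol of fixed
  arity is one that is only used with lists of that length. The rewriting below never changes the
  length of an argument list.
\<close>

datatype quantifier = Exists | Forall

datatype binary_connective = Conj | Disj | Imp | Iff

datatype ('v, 'f, 'p) tm =
    Var nat
  | Fun 'f "('v, 'f, 'p) tm list"
  | Epsilon "('v, 'f, 'p) fm"
and ('v, 'f, 'p) fm =
    Formula_Var 'v
  | Pred 'p "('v, 'f, 'p) tm list"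
  | Neg "('v, 'f, 'p) fm"
  | Bin binary_connective "('v, 'f, 'p) fm" "('v, 'f, 'p) fm"
  | Quant quantifier "('v, 'f, 'p) fm"

text \<open>Increment all indices that are at least \<open>k\<close>.\<close>

primrec lift_tm :: "('v, 'f, 'p) tm \<Rightarrow> nat \<Rightarrow> ('v, 'f, 'p) tm"
  and lift_fm :: "('v, 'f, 'p) fm \<Rightarrow> nat \<Rightarrow> ('v, 'f, 'p) fm" where
  "lift_tm (Var i) k = Var (if i < k then i else Suc i)"
| "lift_tm (Fun f ts) k = Fun f (map (\<lambda>t. lift_tm t k) ts)"
| "lift_tm (Epsilon A) k = Epsilon (lift_fm A (Suc k))"
| "lift_fm (Formula_Var v) k = Formula_Var v"
| "lift_fm (Pred p ts) k = Pred p (map (\<lambda>t. lift_tm t k) ts)"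
| "lift_fm (Neg A) k = Neg (lift_fm A k)"
| "lift_fm (Bin c A B) k = Bin c (lift_fm A k) (lift_fm B k)"
| "lift_fm (Quant Q A) k = Quant Q (lift_fm A (Suc k))"

text \<open>
  Replace index \<open>k\<close> by \<open>s\<close> and decrement all larger indices, since the binder
  of index \<open>k\<close> is removed. In particular, \<open>subst_fm A t 0\<close> is
  \<open>A{x \<mapsto> t}\<close> for the body \<open>A\<close> of a binder of \<open>x\<close>.
\<close>

primrec subst_tm :: "('v, 'f, 'p) tm \<Rightarrow> ('v, 'f, 'p) tm \<Rightarrow> nat \<Rightarrow> ('v, 'f, 'p) tm"
  and subst_fm :: "('v, 'f, 'p) fm \<Rightarrow> ('v, 'f, 'p) tm \<Rightarrow> nat \<Rightarrow> ('v, 'f, 'p) fm" where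
  "subst_tm (Var i) s k = (if i < k then Var i else if i = k then s else Var (i - 1))"
| "subst_tm (Fun f ts) s k = Fun f (map (\<lambda>t. subst_tm t s k) ts)"
| "subst_tm (Epsilon A) s k = Epsilon (subst_fm A (lift_tm s 0) (Suc k))"
| "subst_fm (Formula_Var v) s k = Formula_Var v"
| "subst_fm (Pred p ts) s k = Pred p (map (\<lambda>t. subst_tm t s k) ts)"
| "subst_fm (Neg A) s k = Neg (subst_fm A s k)"
| "subst_fm (Bin c A B) s k = Bin c (subst_fm A s k) (subst_fm B s k)"
| "subst_fm (Quant Q A) s k = Quant Q (subst_fm A (lift_tm s 0) (Suc k))"

text \<open>The number of occurrences of quantifiers, including those inside epsilon-terms.\<close>

primrec quants_tm :: "('v, 'f, 'p) tm \<Rightarrow> nat"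
  and quants_fm :: "('v, 'f, 'p) fm \<Rightarrow> nat" where
  "quants_tm (Var i) = 0"
| "quants_tm (Fun f ts) = sum_list (map quants_tm ts)"
| "quants_tm (Epsilon A) = quants_fm A"
| "quants_fm (Formula_Var v) = 0"
| "quants_fm (Pred p ts) = sum_list (map quants_tm ts)"
| "quants_fm (Neg A) = quants_fm A"
| "quants_fm (Bin c A B) = quants_fm A + quants_fm B"
| "quants_fm (Quant Q A) = Suc (quants_fm A)"

fun neg_quant :: "quantifier \<Rightarrow> ('v, 'f, 'p) fm \<Rightarrow> ('v, 'f, 'p) fm" where
  "neg_quant Forall A = Neg A"
| "neg_quant Exists A = A"

text \<open>
  The body \<open>A\<close> occurs in \<open>Epsilon (neg_quant Q A)\<close> without lifting, because
  the epsilon-binder takes the place of the quantifier as the binder of index 0.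
\<close>

inductive contract :: "('v, 'f, 'p) fm \<Rightarrow> ('v, 'f, 'p) fm \<Rightarrow> bool" where
  "contract (Quant Q A) (subst_fm A (Epsilon (neg_quant Q A)) 0)"

inductive contract_innermost :: "('v, 'f, 'p) fm \<Rightarrow> ('v, 'f, 'p) fm \<Rightarrow> bool" where
  "quants_fm A = 0 \<Longrightarrow> contract_innermost (Quant Q A) (subst_fm A (Epsilon (neg_quant Q A)) 0)"

text \<open>Replacement of a single subformula occurrence, at any position, according to \<open>R\<close>.\<close>

inductive replace_tm :: "(('v, 'f, 'p) fm \<Rightarrow> ('v, 'f, 'p) fm \<Rightarrow> bool) \<Rightarrow>
    ('v, 'f, 'p) tm \<Rightarrow> ('v, 'f, 'p) tm \<Rightarrow> bool"
  and replace_fm :: "(('v, 'f, 'p) fm \<Rightarrow> ('v, 'f, 'p) fm \<Rightarrow> bool) \<Rightarrow>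
    ('v, 'f, 'p) fm \<Rightarrow> ('v, 'f, 'p) fm \<Rightarrow> bool"
  for R where
  Fun: "replace_tm R t t' \<Longrightarrow> replace_tm R (Fun f (ts @ t # us)) (Fun f (ts @ t' # us))"
| Epsilon: "replace_fm R A A' \<Longrightarrow> replace_tm R (Epsilon A) (Epsilon A')"
| Root: "R A A' \<Longrightarrow> replace_fm R A A'"
| Pred: "replace_tm R t t' \<Longrightarrow> replace_fm R (Pred p (ts @ t # us)) (Pred p (ts @ t' # us))"
| Neg: "replace_fm R A A' \<Longrightarrow> replace_fm R (Neg A) (Neg A')"
| BinL: "replace_fm R A A' \<Longrightarrow> replace_fm R (Bin c A B) (Bin c A' B)"
| BinR: "replace_fm R B B' \<Longrightarrow> replace_fm R (Bin c A B) (Bin c A B')"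
| Quant: "replace_fm R A A' \<Longrightarrow> replace_fm R (Quant Q A) (Quant Q A')"

definition step :: "('v, 'f, 'p) fm \<Rightarrow> ('v, 'f, 'p) fm \<Rightarrow> bool" where
  "step = replace_fm contract"

definition step_innermost :: "('v, 'f, 'p) fm \<Rightarrow> ('v, 'f, 'p) fm \<Rightarrow> bool" where
  "step_innermost = replace_fm contract_innermost"

definition normal :: "('v, 'f, 'p) fm \<Rightarrow> bool" where
  "normal F \<longleftrightarrow> (\<nexists>G. step F G)"

definition normal_form_of :: "('v, 'f, 'p) fm \<Rightarrow> ('v, 'f, 'p) fm \<Rightarrow> bool" where
  "normal_form_of F F' \<longleftrightarrow> step\<^sup>*\<^sup>* F F' \<and> normal F'"

end

(*
  Eliminating quantifiers from the inside out defines by structural recursion an epsilon translation.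
  It commutes with substitution, hence is invariant under arbitrary rewrite steps, and it fixes the
  quantifier-free formulas, which are the normal ones; so it is the unique normal form.  A step
  removes the rewritten quantifier and at worst duplicates others, so it lowers the number of
  quantifiers by at most one, and by exactly one if it is innermost.
*)
theory Submission
  imports Defs
begin

section \<open>Substitution calculus for de Bruijn indices\<close>

lemma lift_lift:
  fixes t :: "('v, 'f, 'p) tm" and A :: "('v, 'f, 'p) fm"
  shows "i \<le> k \<Longrightarrow> lift_tm (lift_tm t i) (Suc k) = lift_tm (lift_tm t k) i"
    and "i \<le> k \<Longrightarrow> lift_fm (lift_fm A i) (Suc k) = lift_fm (lift_fm A k) i"
  by (induction t and A arbitrary: i k and i k) auto

text \<open>The cutoff \<open>j\<close> counts indices after \<open>i\<close> has been removed,
  hence \<open>Suc j\<close> before the removal. The case \<open>i = 0\<close> lets lifting pass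
  through a contracted quantifier in \<open>eps_lift\<close>.\<close>

lemma lift_subst_le:
  fixes t :: "('v, 'f, 'p) tm" and A :: "('v, 'f, 'p) fm"
  shows "i \<le> j \<Longrightarrow> lift_tm (subst_tm t u i) j = subst_tm (lift_tm t (Suc j)) (lift_tm u j) i"
    and "i \<le> j \<Longrightarrow> lift_fm (subst_fm A u i) j = subst_fm (lift_fm A (Suc j)) (lift_tm u j) i"
  by (induction t and A arbitrary: u i j and u i j) (auto simp: lift_lift)

lemma lift_subst_ge:
  fixes t :: "('v, 'f, 'p) tm" and A :: "('v, 'f, 'p) fm"
  shows "i \<le> j \<Longrightarrow> lift_tm (subst_tm t u j) i = subst_tm (lift_tm t i) (lift_tm u i) (Suc j)"
    and "i \<le> j \<Longrightarrow> lift_fm (subst_fm A u j) i = subst_fm (lift_fm A i) (lift_tm u i) (Suc j)"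
  by (induction t and A arbitrary: u i j and u i j) (auto simp: lift_lift)

lemma subst_lift [simp]:
  fixes t :: "('v, 'f, 'p) tm" and A :: "('v, 'f, 'p) fm"
  shows "subst_tm (lift_tm t k) s k = t"
    and "subst_fm (lift_fm A k) s k = A"
  by (induction t and A arbitrary: s k and s k) (auto simp: map_idI)

text \<open>This is the usual substitution lemma. While index \<open>i\<close> is still present,
  \<open>s\<close> has to be lifted past it and \<open>j\<close> becomes \<open>Suc j\<close>;
  \<open>subst_lift\<close> cancels that lift where \<open>s\<close> is inserted.\<close>

lemma subst_subst:
  fixes t :: "('v, 'f, 'p) tm" and A :: "('v, 'f, 'p) fm"
  shows "i \<le> j \<Longrightarrow> subst_tm (subst_tm t u i) s j =
      subst_tm (subst_tm t (lift_tm s i) (Suc j)) (subst_tm u s j) i"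
    and "i \<le> j \<Longrightarrow> subst_fm (subst_fm A u i) s j =
      subst_fm (subst_fm A (lift_tm s i) (Suc j)) (subst_tm u s j) i"
  by (induction t and A arbitrary: u s i j and u s i j) (auto simp: lift_lift lift_subst_ge)

section \<open>Quantifier counts under lifting and substitution\<close>

lemma quants_lift [simp]:
  fixes t :: "('v, 'f, 'p) tm" and A :: "('v, 'f, 'p) fm"
  shows "quants_tm (lift_tm t k) = quants_tm t"
    and "quants_fm (lift_fm A k) = quants_fm A"
  by (induction t and A arbitrary: k and k) (auto intro!: arg_cong[where f = sum_list])

text \<open>Only variables are replaced, and they contain no quantifiers, so none can get lost,
  however many copies of \<open>s\<close> are inserted.\<close>

lemma quants_subst_ge:
  fixes t :: "('v, 'f, 'p) tm" and A :: "('v, 'f, 'p) fm"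
  shows "quants_tm t \<le> quants_tm (subst_tm t s k)"
    and "quants_fm A \<le> quants_fm (subst_fm A s k)"
  by (induction t and A arbitrary: s k and s k) (auto intro!: sum_list_mono add_mono)

lemma quants_subst_eq:
  fixes t :: "('v, 'f, 'p) tm" and A :: "('v, 'f, 'p) fm"
  shows "quants_tm s = 0 \<Longrightarrow> quants_tm (subst_tm t s k) = quants_tm t"
    and "quants_tm s = 0 \<Longrightarrow> quants_fm (subst_fm A s k) = quants_fm A"
  by (induction t and A arbitrary: s k and s k) (auto intro!: arg_cong[where f = sum_list])

section \<open>The epsilon translation\<close>

lemma neg_quant_simps [simp]:
  "quants_fm (neg_quant Q A) = quants_fm A"
  "lift_fm (neg_quant Q A) k = neg_quant Q (lift_fm A k)"
  "subst_fm (neg_quant Q A) s k = neg_quant Q (subst_fm A s k)"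
  by (cases Q; simp)+

text \<open>The quantifier clause contracts the already translated body, so it mirrors an innermost
  step.\<close>

primrec eps_tm :: "('v, 'f, 'p) tm \<Rightarrow> ('v, 'f, 'p) tm"
  and eps_fm :: "('v, 'f, 'p) fm \<Rightarrow> ('v, 'f, 'p) fm" where
  "eps_tm (Var i) = Var i"
| "eps_tm (Fun f ts) = Fun f (map eps_tm ts)"
| "eps_tm (Epsilon A) = Epsilon (eps_fm A)"
| "eps_fm (Formula_Var v) = Formula_Var v"
| "eps_fm (Pred p ts) = Pred p (map eps_tm ts)"
| "eps_fm (Neg A) = Neg (eps_fm A)"
| "eps_fm (Bin c A B) = Bin c (eps_fm A) (eps_fm B)"
| "eps_fm (Quant Q A) = subst_fm (eps_fm A) (Epsilon (neg_quant Q (eps_fm A))) 0"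

lemma eps_neg_quant [simp]: "eps_fm (neg_quant Q A) = neg_quant Q (eps_fm A)"
  by (cases Q; simp)

lemma eps_lift:
  fixes t :: "('v, 'f, 'p) tm" and A :: "('v, 'f, 'p) fm"
  shows "eps_tm (lift_tm t k) = lift_tm (eps_tm t) k"
    and "eps_fm (lift_fm A k) = lift_fm (eps_fm A) k"
  by (induction t and A arbitrary: k and k) (auto simp: lift_subst_le)

text \<open>In the quantifier case \<open>subst_subst\<close> moves the substitution past the
  contraction. With \<open>s\<close> the inserted epsilon-term, the translation of a contractum
  becomes the quantifier clause of \<open>eps_fm\<close>; hence the invariance in
  \<open>eps_replace\<close>.\<close>

lemma eps_subst:
  fixes t :: "('v, 'f, 'p) tm" and A :: "('v, 'f, 'p) fm"
  shows "eps_tm (subst_tm t s k) = subst_tm (eps_tm t) (eps_tm s) k"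
    and "eps_fm (subst_fm A s k) = subst_fm (eps_fm A) (eps_tm s) k"
  by (induction t and A arbitrary: s k and s k) (auto simp: eps_lift subst_subst)

lemma quants_eps [simp]:
  fixes t :: "('v, 'f, 'p) tm" and A :: "('v, 'f, 'p) fm"
  shows "quants_tm (eps_tm t) = 0" and "quants_fm (eps_fm A) = 0"
  by (induction t and A) (auto simp: quants_subst_eq)

lemma eps_quantifier_free:
  fixes t :: "('v, 'f, 'p) tm" and A :: "('v, 'f, 'p) fm"
  shows "quants_tm t = 0 \<Longrightarrow> eps_tm t = t" and "quants_fm A = 0 \<Longrightarrow> eps_fm A = A"
  by (induction t and A) (auto simp: map_idI)

section \<open>Effect of a single step\<close>

lemma eps_replace:
  fixes t t' :: "('v, 'f, 'p) tm" and F G :: "('v, 'f, 'p) fm"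
  shows "replace_tm contract t t' \<Longrightarrow> eps_tm t = eps_tm t'"
    and "replace_fm contract F G \<Longrightarrow> eps_fm F = eps_fm G"
  by (induction rule: replace_tm_replace_fm.inducts) (auto elim!: contract.cases simp: eps_subst)

text \<open>At the root one quantifier disappears and \<open>quants_subst_ge\<close> prevents any
  further loss; contexts merely add a constant to both counts.\<close>

lemma quants_replace_le:
  fixes t t' :: "('v, 'f, 'p) tm" and F G :: "('v, 'f, 'p) fm"
  shows "replace_tm contract t t' \<Longrightarrow> quants_tm t \<le> Suc (quants_tm t')"
    and "replace_fm contract F G \<Longrightarrow> quants_fm F \<le> Suc (quants_fm G)"
  by (induction rule: replace_tm_replace_fm.inducts)
    (auto elim!: contract.cases simp: quants_subst_ge)

text \<open>The body is quantifier-free, so the inserted epsilon-term is too, and its copies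
  contribute nothing to the count.\<close>

lemma quants_replace_innermost:
  fixes t t' :: "('v, 'f, 'p) tm" and F G :: "('v, 'f, 'p) fm"
  shows "replace_tm contract_innermost t t' \<Longrightarrow> quants_tm t = Suc (quants_tm t')"
    and "replace_fm contract_innermost F G \<Longrightarrow> quants_fm F = Suc (quants_fm G)"
  by (induction rule: replace_tm_replace_fm.inducts)
    (auto elim!: contract_innermost.cases simp: quants_subst_eq)

lemma replace_mono:
  assumes "\<And>A B. R A B \<Longrightarrow> S A B"
  shows "replace_tm R t t' \<Longrightarrow> replace_tm S t t'"
    and "replace_fm R F G \<Longrightarrow> replace_fm S F G"
  by (induction rule: replace_tm_replace_fm.inducts)
    (auto intro: replace_tm_replace_fm.intros assms)

lemma step_if_step_innermost: "step_innermost F G \<Longrightarrow> step F G"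
  unfolding step_def step_innermost_def
  by (rule replace_mono(2)[of contract_innermost])
    (auto elim: contract_innermost.cases intro: contract.intros)

section \<open>Derivations of exact length to the translation\<close>

lemma relpowp_map:
  assumes "(R ^^ n) x y" and "\<And>a b. R a b \<Longrightarrow> S (f a) (f b)"
  shows "(S ^^ n) (f x) (f y)"
  using assms(1) by (induction n arbitrary: y) (auto intro: assms(2))

text \<open>Arguments are rewritten from left to right. The prefix \<open>us\<close> generalises the
  claim so that finished arguments can be moved into it during the induction.\<close>

lemma relpowp_map_list:
  assumes "\<And>t. t \<in> set ts \<Longrightarrow> (R ^^ n t) t (g t)"
    and "\<And>us t t' vs. R t t' \<Longrightarrow> S (f (us @ t # vs)) (f (us @ t' # vs))"
  shows "(S ^^ sum_list (map n ts)) (f (us @ ts)) (f (us @ map g ts))"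
  using assms(1)
proof (induction ts arbitrary: us)
  case (Cons t ts)
  have "(S ^^ n t) (f (us @ t # ts)) (f (us @ g t # ts))"
    by (rule relpowp_map[where R = R and f = "\<lambda>t. f (us @ t # ts)"]) (use Cons.prems in \<open>auto intro: assms(2)\<close>)
  moreover have "(S ^^ sum_list (map n ts)) (f (us @ g t # ts)) (f (us @ g t # map g ts))"
    using Cons.IH[of "us @ [g t]"] Cons.prems by simp
  ultimately show ?case
    unfolding list.simps sum_list.Cons by (rule relpowp_trans)
qed simp

text \<open>Working from the inside out spends one step per original quantifier, because no
  quantifier is ever copied. This gives both the existence of the normal form and a derivation of
  the optimal length.\<close>

lemma replace_eps:
  fixes t :: "('v, 'f, 'p) tm" and A :: "('v, 'f, 'p) fm"
  shows "(replace_tm contract ^^ quants_tm t) t (eps_tm t)"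
    and "(replace_fm contract ^^ quants_fm A) A (eps_fm A)"
proof (induction t and A)
  case (Fun f ts)
  have "(replace_tm contract ^^ sum_list (map quants_tm ts))
      (Fun f ([] @ ts)) (Fun f ([] @ map eps_tm ts))"
    by (rule relpowp_map_list[where f = "Fun f", OF Fun]) (auto intro: replace_tm_replace_fm.Fun)
  then show ?case
    by simp
next
  case (Epsilon A)
  show ?case
    unfolding quants_tm.simps eps_tm.simps
    by (rule relpowp_map[where f = Epsilon, OF Epsilon]) (rule replace_tm_replace_fm.Epsilon)
next
  case (Pred p ts)
  have "(replace_fm contract ^^ sum_list (map quants_tm ts))
      (Pred p ([] @ ts)) (Pred p ([] @ map eps_tm ts))"
    by (rule relpowp_map_list[where f = "Pred p", OF Pred]) (auto intro: replace_tm_replace_fm.Pred)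
  then show ?case
    by simp
next
  case (Neg A)
  show ?case
    unfolding quants_fm.simps eps_fm.simps
    by (rule relpowp_map[where f = Neg, OF Neg]) (rule replace_tm_replace_fm.Neg)
next
  case (Bin c A B)
  have "(replace_fm contract ^^ quants_fm A) (Bin c A B) (Bin c (eps_fm A) B)"
    by (rule relpowp_map[where f = "\<lambda>A. Bin c A B", OF Bin(1)]) (rule replace_tm_replace_fm.BinL)
  moreover have "(replace_fm contract ^^ quants_fm B) (Bin c (eps_fm A) B) (eps_fm (Bin c A B))"
    unfolding eps_fm.simps
    by (rule relpowp_map[where f = "Bin c (eps_fm A)", OF Bin(2)]) (rule replace_tm_replace_fm.BinR)
  ultimately show ?case
    unfolding quants_fm.simps by (rule relpowp_trans)
next
  case (Quant Q A)
  have "(replace_fm contract ^^ quants_fm A) (Quant Q A) (Quant Q (eps_fm A))"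
    by (rule relpowp_map[where f = "Quant Q", OF Quant]) (rule replace_tm_replace_fm.Quant)
  \<comment> \<open>The one additional step, at the root, is literally the quantifier clause of
    \<open>eps_fm\<close>.\<close>
  moreover have "replace_fm contract (Quant Q (eps_fm A)) (eps_fm (Quant Q A))"
    by (auto intro: replace_tm_replace_fm.Root contract.intros)
  ultimately show ?case
    by auto
qed auto

section \<open>Normal forms and lengths of derivations\<close>

lemma quants_pos_if_replace:
  fixes t t' :: "('v, 'f, 'p) tm" and F G :: "('v, 'f, 'p) fm"
  shows "replace_tm contract t t' \<Longrightarrow> quants_tm t > 0"
    and "replace_fm contract F G \<Longrightarrow> quants_fm F > 0"
  by (induction rule: replace_tm_replace_fm.inducts) (auto elim!: contract.cases)

lemma normal_iff_quantifier_free: "normal F \<longleftrightarrow> quants_fm F = 0"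
proof
  assume "normal F"
  show "quants_fm F = 0"
  proof (cases "quants_fm F")
    \<comment> \<open>The derivation from \<open>replace_eps\<close> now has positive length, and
      its first step contradicts normality.\<close>
    case (Suc k)
    then obtain G where "step F G"
      using replace_eps(2)[of F] unfolding step_def by (metis relpowp_Suc_D2)
    with \<open>normal F\<close> show ?thesis
      unfolding normal_def by blast
  qed
next
  assume "quants_fm F = 0"
  then show "normal F"
    unfolding normal_def step_def using quants_pos_if_replace(2)[of F] by auto
qed

lemma quants_le_steps: "(step ^^ m) F G \<Longrightarrow> quants_fm F \<le> m + quants_fm G"
proof (induction m arbitrary: G)
  case (Suc m)
  then obtain H where "(step ^^ m) F H" "step H G"
    by auto
  then show ?case
    using Suc.IH[of H] quants_replace_le(2)[of H G] by (simp add: step_def)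
qed simp

lemma quants_eq_steps_innermost:
  "(step_innermost ^^ m) F G \<Longrightarrow> quants_fm F = m + quants_fm G"
proof (induction m arbitrary: G)
  case (Suc m)
  then obtain H where "(step_innermost ^^ m) F H" "step_innermost H G"
    by auto
  then show ?case
    using Suc.IH[of H] quants_replace_innermost(2)[of H G] by (simp add: step_innermost_def)
qed simp

lemma eps_steps: "step\<^sup>*\<^sup>* F G \<Longrightarrow> eps_fm F = eps_fm G"
  by (induction rule: rtranclp_induct) (auto simp: step_def eps_replace)

text \<open>Uniqueness comes from an invariant: \<open>eps_fm\<close> is constant along derivations
  and fixes normal formulas. Existence is \<open>replace_eps\<close>.\<close>

lemma normal_form_of_iff: "normal_form_of F F' \<longleftrightarrow> F' = eps_fm F"
proof
  assume "normal_form_of F F'"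
  then show "F' = eps_fm F"
    by (metis eps_quantifier_free(2) eps_steps normal_form_of_def normal_iff_quantifier_free)
next
  assume "F' = eps_fm F"
  then show "normal_form_of F F'"
    using replace_eps(2)[of F]
    by (auto simp: normal_form_of_def normal_iff_quantifier_free step_def dest: relpowp_imp_rtranclp)
qed

theorem theorem3p9:
  fixes F :: "('v, 'f, 'p) fm" and n :: nat
  assumes "quants_fm F = n"
  shows "(\<exists>!F'. normal_form_of F F') \<and>
    (\<forall>F'. normal_form_of F F' \<longrightarrow>
      (\<forall>G m. (step_innermost ^^ m) F G \<and> normal G \<longrightarrow> G = F' \<and> m = n) \<and>
      (step ^^ n) F F' \<and>
      (\<forall>m. (step ^^ m) F F' \<longrightarrow> n \<le> m))"
proof -
  have "G = eps_fm F \<and> m = n" if "(step_innermost ^^ m) F G" "normal G" for G m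
  proof
    \<comment> \<open>Innermost steps are ordinary steps, so the normal formula \<open>G\<close> is
      a normal form of \<open>F\<close>.\<close>
    have "(step ^^ m) F G"
      by (rule relpowp_mono[OF step_if_step_innermost that(1)])
    then show "G = eps_fm F"
      using that(2) by (auto simp flip: normal_form_of_iff simp: normal_form_of_def dest: relpowp_imp_rtranclp)
    show "m = n"
      using quants_eq_steps_innermost[OF that(1)] that(2) assms
      by (simp add: normal_iff_quantifier_free)
  qed
  moreover have "(step ^^ n) F (eps_fm F)"
    using replace_eps(2)[of F] assms by (simp add: step_def)
  \<comment> \<open>All \<open>n\<close> quantifiers must vanish, and each step removes at most one
    on balance.\<close>
  moreover have "n \<le> m" if "(step ^^ m) F (eps_fm F)" for m
    using quants_le_steps[OF that] assms by simp
  ultimately show ?thesis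
    by (auto simp: normal_form_of_iff)
qed

end
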